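(* Let $d\ge 1$ be a fixed integer, and let $s_d(n)$ denote the number of $d$-dimensional simple jump paths starting at $(n,n,\dots,n)$ and ending at the origin. Then, as $n\to\infty$, $$s_d(n+1)\ \sim\ 2^{nd}\left(\frac{\pi n}{2}\right)^{-\frac d2+\frac12} d^{-1/2},$$ i.e. the ratio of the two sides tends to $1$.
   Context: A $d$-dimensional simple jump path of length $k\ge 1$ (i.e. with $k$ steps) starting at $(a_1,\dots,a_d)$, where the $a_j$ are positive integers, is a sequence of points $\{(x_{i,1},\dots,x_{i,d})\}_{i=0}^{k}$ with non-negative integer coordinates such that $(x_{0,1},\dots,x_{0,d})=(a_1,\dots,a_d)$, $(x_{k,1},\dots,x_{k,d})=(0,\dots,0)$, and $x_{i,j}>x_{i+1,j}$ for all $i\in\{0,\dots,k-1\}$ and all $j\in\{1,\dots,d\}$ (every coordinate strictly decreases at every step). The count $s_d(n)$ includes paths of all lengths. *)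

theory Defs
  imports Complex_Main "HOL-Library.Landau_Symbols"
begin

text \<open>
  Points with \<open>d\<close> non-negative integer coordinates are lists of naturals of length \<open>d\<close>.
  A path with \<open>k\<close> steps is the list of its \<open>k + 1\<close> points.
\<close>

definition simple_jump_path :: "nat \<Rightarrow> nat list \<Rightarrow> nat \<Rightarrow> nat list list \<Rightarrow> bool" where
  "simple_jump_path d a k xs \<longleftrightarrow>
     k \<ge> 1 \<and> length xs = k + 1 \<and> (\<forall>i\<le>k. length (xs ! i) = d) \<and>
     xs ! 0 = a \<and> xs ! k = replicate d 0 \<and>
     (\<forall>i<k. \<forall>j<d. xs ! i ! j > xs ! (i + 1) ! j)"

text \<open>
  For \<open>d \<ge> 1\<close> the set counted here is finite, since a path has at most \<open>n\<close> steps.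
\<close>

definition num_simple_jump_paths :: "nat \<Rightarrow> nat \<Rightarrow> nat" where
  "num_simple_jump_paths d n = card {xs. \<exists>k. simple_jump_path d (replicate d n) k xs}"

end

theory Submission
  imports Defs "HOL-Probability.Distributions" "HOL-Real_Asymp.Real_Asymp"
begin

text \<open>
  Reading a path coordinate by coordinate, a path with \<open>k\<close> steps from \<open>(n+1,\<dots>,n+1)\<close> to the
  origin is a \<open>d\<close>-tuple of strictly decreasing sequences of length \<open>k + 1\<close> from \<open>n + 1\<close> to \<open>0\<close>.
  The coordinates are independent, and each sequence is determined by its set of \<open>k - 1\<close>
  intermediate values in \<open>{1..n}\<close>. Hence \<open>s\<^sub>d(n+1) = (\<Sum>k\<le>n. (n choose k) ^ d)\<close>
  (\<open>num_simple_jump_paths_eq_sum\<close>).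

  The asymptotics of this power sum come from the Gaussian shape of a row of Pascal's triangle.
  Let \<open>c\<^sub>n\<close> be the central binomial coefficient. Bounding the quotients of consecutive
  coefficients yields, for a distance \<open>j\<close> from the centre, bounds for the ratio to \<open>c\<^sub>n\<close> of the form
  \<open>exp (- j (j \<plusminus> 1) / (n/2 \<minusplus> j))\<close>. With \<open>j \<approx> x sqrt n\<close> both bounds
  tend to \<open>exp (- 2 x\<^sup>2)\<close> (\<open>central_ratio_tendsto\<close>), and a variant
  of the upper bound gives an integrable majorant that does not depend on \<open>n\<close>
  (\<open>central_ratio_dominated\<close>).
  Written as the integral of a step function, the power sum divided by \<open>c\<^sub>n ^ d * sqrt n\<close> therefore
  converges, by dominated convergence, to \<open>\<integral> exp (- 2 d x\<^sup>2) dx = sqrt (pi / (2 d))\<close>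
  (\<open>sum_binomial_power_tendsto\<close>).

  The size of \<open>c\<^sub>n\<close> is the case \<open>d = 1\<close> of this limit: the sum is then
  exactly \<open>2 ^ n\<close>, which gives \<open>c\<^sub>n ~ 2 ^ n / sqrt (pi n / 2)\<close>. Substituting
  this for arbitrary \<open>d\<close> gives the theorem.
\<close>

section \<open>Counting paths\<close>

definition descending_seqs :: "nat \<Rightarrow> nat \<Rightarrow> nat list set" where
  "descending_seqs n k = {ys. length ys = k + 1 \<and> ys ! 0 = n \<and> ys ! k = 0 \<and> sorted_wrt (>) ys}"

lemma sorted_wrt_greater_iff:
  "sorted_wrt (>) (ys :: nat list) \<longleftrightarrow> (\<forall>i. Suc i < length ys \<longrightarrow> ys ! i > ys ! Suc i)"
  by (auto simp: sorted_wrt_iff_nth_Suc_transp transp_def)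

text \<open>
  A strictly decreasing sequence is recovered from its set of values by sorting; since the two ends
  are prescribed, only the intermediate values are free.
\<close>

lemma bij_betw_descending_seqs:
  assumes "k \<ge> 1"
  shows "bij_betw (\<lambda>A. rev (sorted_list_of_set (insert 0 (insert (n + 1) A))))
           {A. A \<subseteq> {1..n} \<and> card A = k - 1} (descending_seqs (n + 1) k)"
proof (rule bij_betw_byWitness[where f' = "\<lambda>ys. set ys - {0, n + 1}"])
  show "\<forall>A\<in>{A. A \<subseteq> {1..n} \<and> card A = k - 1}.
          set (rev (sorted_list_of_set (insert 0 (insert (n + 1) A)))) - {0, n + 1} = A"
  proof
    fix A assume "A \<in> {A. A \<subseteq> {1..n} \<and> card A = k - 1}"
    then have "A \<subseteq> {1..n}" "finite A" by (auto intro: finite_subset)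
    moreover have "set (sorted_list_of_set (insert 0 (insert (n + 1) A))) = insert 0 (insert (n + 1) A)"
      using \<open>finite A\<close> by (intro set_sorted_list_of_set) simp
    ultimately show "set (rev (sorted_list_of_set (insert 0 (insert (n + 1) A)))) - {0, n + 1} = A"
      unfolding set_rev by auto
  qed
next
  have ends: "set ys = insert 0 (insert (n + 1) (set ys - {0, n + 1}))" if "ys \<in> descending_seqs (n + 1) k" for ys
  proof -
    have "length ys = k + 1" using that by (simp add: descending_seqs_def)
    then have "ys ! 0 \<in> set ys" "ys ! k \<in> set ys" by (simp_all only: nth_mem)
    then show ?thesis using that by (auto simp: descending_seqs_def)
  qed
  show "\<forall>ys\<in>descending_seqs (n + 1) k.
      rev (sorted_list_of_set (insert 0 (insert (n + 1) (set ys - {0, n + 1})))) = ys"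
  proof
    fix ys assume ys: "ys \<in> descending_seqs (n + 1) k"
    have "sorted_wrt (<) (rev ys)" using ys by (simp add: descending_seqs_def sorted_wrt_rev)
    then have "sorted_list_of_set (set (rev ys)) = rev ys"
      by (metis sorted_list_of_set.idem_if_sorted_distinct strict_sorted_iff)
    then show "rev (sorted_list_of_set (insert 0 (insert (n + 1) (set ys - {0, n + 1})))) = ys"
      using ends[OF ys] by simp
  qed
  show "(\<lambda>ys. set ys - {0, n + 1}) ` descending_seqs (n + 1) k \<subseteq> {A. A \<subseteq> {1..n} \<and> card A = k - 1}"
  proof (rule image_subsetI)
    fix ys assume ys: "ys \<in> descending_seqs (n + 1) k"
    have "x \<in> {1..n}" if x: "x \<in> set ys" "x \<noteq> 0" "x \<noteq> n + 1" for x
    proof -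
      from x obtain i where i: "i < length ys" "x = ys ! i" by (auto simp: in_set_conv_nth)
      with x ys have "i > 0" by (auto simp: descending_seqs_def intro: Nat.gr0I)
      have "sorted_wrt (>) ys" using ys by (simp add: descending_seqs_def)
      from sorted_wrt_nth_less[OF this \<open>i > 0\<close> i(1)] have "ys ! i < ys ! 0" .
      with i x ys show ?thesis by (auto simp: descending_seqs_def)
    qed
    then have sub: "set ys - {0, n + 1} \<subseteq> {1..n}" by blast
    have "sorted_wrt (<) (rev ys)" using ys by (simp add: descending_seqs_def sorted_wrt_rev)
    then have "distinct ys" by (simp add: strict_sorted_iff)
    then have "card (set ys) = k + 1" using ys by (simp add: distinct_card descending_seqs_def)
    moreover have "{0, n + 1} \<subseteq> set ys" using ends[OF ys] by blast
    ultimately have "card (set ys - {0, n + 1}) = k - 1"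
      by (subst card_Diff_subset) auto
    with sub show "set ys - {0, n + 1} \<in> {A. A \<subseteq> {1..n} \<and> card A = k - 1}" by simp
  qed
  show "(\<lambda>A. rev (sorted_list_of_set (insert 0 (insert (n + 1) A)))) `
          {A. A \<subseteq> {1..n} \<and> card A = k - 1} \<subseteq> descending_seqs (n + 1) k"
  proof (rule image_subsetI)
    fix A assume "A \<in> {A. A \<subseteq> {1..n} \<and> card A = k - 1}"
    then have A: "A \<subseteq> {1..n}" "card A = k - 1" by auto
    then have fin: "finite A" and notin: "0 \<notin> A" "n + 1 \<notin> A" by (auto dest: finite_subset)
    define S where "S = insert 0 (insert (n + 1) A)"
    have S: "finite S" "S \<noteq> {}" "card S = k + 1" "n + 1 \<in> S" "\<And>x. x \<in> S \<Longrightarrow> x \<le> n + 1" "Min S = 0"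
      using A fin notin assms by (auto simp: S_def intro!: Min_eqI)
    let ?l = "sorted_list_of_set S"
    have len: "length ?l = k + 1" using S by simp
    have set_l: "set ?l = S" using S by simp
    have first: "?l ! 0 = 0"
      using S by (metis sorted_list_of_set_nonempty nth_Cons_0)
    have sd: "sorted_wrt (<) ?l" by simp
    from S(4) obtain i where i: "i < k + 1" "?l ! i = n + 1" by (metis in_set_conv_nth len set_l)
    have "?l ! k \<in> set ?l" by (rule nth_mem) (simp only: len)
    then have le: "?l ! k \<le> n + 1" using S(5) set_l by simp
    have "i = k"
    proof (rule ccontr)
      assume "i \<noteq> k"
      then have "?l ! i < ?l ! k"
        using i sorted_wrt_nth_less[OF sd, of i k] len by simp
      with i le show False by simp
    qed
    with i have last: "?l ! k = n + 1" by simp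
    show "rev (sorted_list_of_set (insert 0 (insert (n + 1) A))) \<in> descending_seqs (n + 1) k"
      unfolding descending_seqs_def S_def[symmetric] using len first last sd
      by (simp add: rev_nth sorted_wrt_rev)
  qed
qed

lemma card_descending_seqs:
  assumes "k \<ge> 1"
  shows "card (descending_seqs (n + 1) k) = n choose (k - 1)"
  using bij_betw_same_card[OF bij_betw_descending_seqs[OF assms, of n]] n_subsets[of "{1..n}" "k - 1"]
  by simp

text \<open>
  The bijection is transposition: the list of the points of a path, read as a matrix, becomes the
  list of its \<open>d\<close> coordinate sequences. The condition on the steps involves each coordinate separately.
\<close>

lemma card_simple_jump_paths:
  assumes "k \<ge> 1"
  shows "card {xs. simple_jump_path d (replicate d (n + 1)) k xs} = (n choose (k - 1)) ^ d"
proof -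
  let ?L = "{yss. set yss \<subseteq> descending_seqs (n + 1) k \<and> length yss = d}"
  let ?P = "{xs. simple_jump_path d (replicate d (n + 1)) k xs}"
  have "bij_betw (\<lambda>yss. map (\<lambda>i. map (\<lambda>ys. ys ! i) yss) [0..<k+1]) ?L ?P"
  proof (rule bij_betw_byWitness[where f' = "\<lambda>xs. map (\<lambda>j. map (\<lambda>p. p ! j) xs) [0..<d]"])
    show "\<forall>yss\<in>?L. map (\<lambda>j. map (\<lambda>p. p ! j) (map (\<lambda>i. map (\<lambda>ys. ys ! i) yss) [0..<k+1])) [0..<d] = yss"
    proof
      fix yss assume "yss \<in> ?L"
      then have len: "length yss = d" and mem: "\<And>j. j < d \<Longrightarrow> yss ! j \<in> descending_seqs (n + 1) k"
        by auto
      show "map (\<lambda>j. map (\<lambda>p. p ! j) (map (\<lambda>i. map (\<lambda>ys. ys ! i) yss) [0..<k+1])) [0..<d] = yss"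
      proof (rule nth_equalityI)
        fix j assume "j < length (map (\<lambda>j. map (\<lambda>p. p ! j) (map (\<lambda>i. map (\<lambda>ys. ys ! i) yss) [0..<k+1])) [0..<d])"
        then have j: "j < d" by simp
        have "length (yss ! j) = k + 1" using mem[OF j] by (simp add: descending_seqs_def)
        then show "map (\<lambda>j. map (\<lambda>p. p ! j) (map (\<lambda>i. map (\<lambda>ys. ys ! i) yss) [0..<k+1])) [0..<d] ! j = yss ! j"
          using j len by (intro nth_equalityI) (simp_all del: upt_Suc)
      qed (simp add: len)
    qed
    show "\<forall>xs\<in>?P. map (\<lambda>i. map (\<lambda>ys. ys ! i) (map (\<lambda>j. map (\<lambda>p. p ! j) xs) [0..<d])) [0..<k+1] = xs"
    proof
      fix xs assume "xs \<in> ?P"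
      then have len: "length xs = k + 1" and len': "\<And>i. i < k + 1 \<Longrightarrow> length (xs ! i) = d"
        by (auto simp: simple_jump_path_def)
      show "map (\<lambda>i. map (\<lambda>ys. ys ! i) (map (\<lambda>j. map (\<lambda>p. p ! j) xs) [0..<d])) [0..<k+1] = xs"
        using len len' by (intro nth_equalityI) (simp_all del: upt_Suc)
    qed
    show "(\<lambda>yss. map (\<lambda>i. map (\<lambda>ys. ys ! i) yss) [0..<k+1]) ` ?L \<subseteq> ?P"
    proof (rule image_subsetI)
      fix yss assume "yss \<in> ?L"
      then have len: "length yss = d" and mem: "\<And>j. j < d \<Longrightarrow> yss ! j \<in> descending_seqs (n + 1) k"
        by auto
      define xs where "xs = map (\<lambda>i. map (\<lambda>ys. ys ! i) yss) [0..<k+1]"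
      have xs: "xs ! i = map (\<lambda>ys. ys ! i) yss" if "i \<le> k" for i
        using that unfolding xs_def by (subst nth_map) (auto simp del: upt_Suc)
      have "xs ! 0 = replicate d (n + 1)" "xs ! k = replicate d 0"
        using mem len xs[of 0] xs[of k] by (auto intro!: nth_equalityI simp: descending_seqs_def)
      moreover have "xs ! (i + 1) ! j < xs ! i ! j" if "i < k" "j < d" for i j
        using that mem[of j] len xs[of i] xs[of "i + 1"]
        by (simp add: descending_seqs_def sorted_wrt_greater_iff)
      moreover have "length xs = k + 1" by (simp add: xs_def)
      moreover have "\<forall>i\<le>k. length (xs ! i) = d" using xs len by simp
      ultimately show "map (\<lambda>i. map (\<lambda>ys. ys ! i) yss) [0..<k+1] \<in> ?P"
        using assms unfolding xs_def[symmetric] simple_jump_path_def by simp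
    qed
    show "(\<lambda>xs. map (\<lambda>j. map (\<lambda>p. p ! j) xs) [0..<d]) ` ?P \<subseteq> ?L"
    proof (rule image_subsetI)
      fix xs assume "xs \<in> ?P"
      then have P: "simple_jump_path d (replicate d (n + 1)) k xs" by simp
      have "map (\<lambda>p. p ! j) xs \<in> descending_seqs (n + 1) k" if "j < d" for j
        using P that by (simp add: simple_jump_path_def descending_seqs_def sorted_wrt_greater_iff)
      then show "map (\<lambda>j. map (\<lambda>p. p ! j) xs) [0..<d] \<in> ?L" by auto
    qed
  qed
  then have "card ?P = card ?L" by (rule bij_betw_same_card[symmetric])
  moreover have "finite (descending_seqs (n + 1) k)"
    using bij_betw_finite[OF bij_betw_descending_seqs[OF assms, of n]] by simp
  ultimately show ?thesis
    using card_lists_length_eq[of "descending_seqs (n + 1) k" d] card_descending_seqs[OF assms, of n] by simp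
qed

lemma simple_jump_path_length_le:
  assumes "simple_jump_path d (replicate d n) k xs" "d \<ge> 1"
  shows "k \<le> n"
proof -
  have "i \<le> k \<Longrightarrow> xs ! i ! 0 + i \<le> n" for i
  proof (induction i)
    case 0
    then show ?case using assms by (simp add: simple_jump_path_def)
  next
    case (Suc i)
    have "xs ! i ! 0 > xs ! (i + 1) ! 0" using assms Suc.prems by (simp add: simple_jump_path_def)
    then show ?case using Suc by simp
  qed
  from this[of k] show ?thesis by simp
qed

lemma num_simple_jump_paths_eq_sum:
  assumes "d \<ge> 1"
  shows "num_simple_jump_paths d (n + 1) = (\<Sum>k\<le>n. (n choose k) ^ d)"
proof -
  let ?P = "\<lambda>k. {xs. simple_jump_path d (replicate d (n + 1)) k xs}"
  have fin: "finite (?P k)" if "k \<in> {1..n + 1}" for k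
  proof (rule card_ge_0_finite)
    have "n choose (k - 1) > 0" using that by (intro zero_less_binomial) auto
    then show "card (?P k) > 0" using that card_simple_jump_paths[of k d n] by simp
  qed
  have "{xs. \<exists>k. simple_jump_path d (replicate d (n + 1)) k xs} = (\<Union>k\<in>{1..n + 1}. ?P k)"
  proof (intro equalityI subsetI)
    fix xs assume "xs \<in> {xs. \<exists>k. simple_jump_path d (replicate d (n + 1)) k xs}"
    then obtain k where k: "simple_jump_path d (replicate d (n + 1)) k xs" by blast
    have "1 \<le> k" using k by (simp add: simple_jump_path_def)
    moreover have "k \<le> n + 1" using simple_jump_path_length_le[OF k assms] .
    ultimately show "xs \<in> (\<Union>k\<in>{1..n + 1}. ?P k)" using k by fastforce
  qed blast
  then have "num_simple_jump_paths d (n + 1) = card (\<Union>k\<in>{1..n + 1}. ?P k)"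
    by (simp add: num_simple_jump_paths_def)
  also have "\<dots> = (\<Sum>k\<in>{1..n + 1}. card (?P k))"
    using fin by (intro card_UN_disjoint) (auto simp: simple_jump_path_def)
  also have "\<dots> = (\<Sum>k\<in>{1..n + 1}. (n choose (k - 1)) ^ d)"
    by (intro sum.cong refl card_simple_jump_paths) auto
  also have "\<dots> = (\<Sum>k\<le>n. (n choose k) ^ d)"
    by (rule sum.reindex_bij_witness[of _ Suc "\<lambda>k. k - 1"]) auto
  finally show ?thesis .
qed

section \<open>Gaussian bounds for binomial coefficients\<close>

lemma binomial_Suc_ratio:
  fixes a b j :: nat
  assumes "j < a"
  shows "real (Suc (b + j)) * real ((a + b) choose Suc (b + j)) =
         (real a - real j) * real ((a + b) choose (b + j))"
proof -
  have "Suc (b + j) * ((a + b) choose Suc (b + j)) =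
        (a + b - (b + j)) * ((a + b) choose (b + j))"
    using binomial_absorption[of "b + j" "a + b"] binomial_absorb_comp[of "a + b" "b + j"] by simp
  then have "real (Suc (b + j) * ((a + b) choose Suc (b + j))) =
        real ((a + b - (b + j)) * ((a + b) choose (b + j)))" by simp
  moreover have "real (a + b - (b + j)) = real a - real j" using assms by simp
  ultimately show ?thesis by (metis of_nat_mult)
qed

text \<open>
  Moving from distance \<open>j\<close> to \<open>j + 1\<close> from the centre multiplies the coefficient by
  \<open>(a - j) / (b + j + 1) \<le> 1 - 2 j / N \<le> exp (- 2 j / N)\<close>, and
  \<open>2 * 0 + 2 * 1 + \<dots> + 2 * (j - 1) = j (j - 1)\<close>. Leaving \<open>N\<close> free allows both the sharp choice near
  \<open>n/2 + j\<close>, for the limit, and the choice \<open>N = n\<close>, for the majorant.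
\<close>

lemma binomial_gaussian_upper:
  fixes a b j :: nat and N :: real
  assumes "a \<le> b + 1" "real b + real j \<le> N" "0 < N"
  shows "real ((a + b) choose (b + j)) \<le>
         real ((a + b) choose b) * exp (- (real j * (real j - 1)) / N)"
  using assms(2)
proof (induction j)
  case (Suc j)
  have IH: "real ((a + b) choose (b + j)) \<le>
         real ((a + b) choose b) * exp (- (real j * (real j - 1)) / N)"
    using Suc by simp
  show ?case
  proof (cases "j < a")
    case False
    then have "(a + b) choose (b + Suc j) = 0" by (intro binomial_eq_0) simp
    then show ?thesis by (simp only: of_nat_0) simp
  next
    case True
    note rec = binomial_Suc_ratio[OF True, of b]
    have step: "(real a - real j) / real (Suc (b + j)) \<le> exp (- (2 * real j) / N)"
    proof -
      have "2 * real j / N \<le> 2 * real j / real (Suc (b + j))"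
        using Suc.prems by (intro divide_left_mono) auto
      also have "\<dots> \<le> 1 - (real a - real j) / real (Suc (b + j))"
      proof -
        have "(2 * real j + (real a - real j)) / real (Suc (b + j)) \<le> 1"
          using assms(1) by (subst divide_le_eq_1) auto
        then show ?thesis by (simp only: add_divide_distrib)
      qed
      finally have "(real a - real j) / real (Suc (b + j)) \<le> 1 + (- (2 * real j) / N)" by simp
      also have "\<dots> \<le> exp (- (2 * real j) / N)" by (rule exp_ge_add_one_self)
      finally show ?thesis .
    qed
    have "real ((a + b) choose (b + Suc j)) =
          (real a - real j) / real (Suc (b + j)) * real ((a + b) choose (b + j))"
      using rec by (simp add: field_simps)
    also have "\<dots> \<le> exp (- (2 * real j) / N) *
        (real ((a + b) choose b) * exp (- (real j * (real j - 1)) / N))"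
      using step IH True by (intro mult_mono) auto
    also have "\<dots> = real ((a + b) choose b) *
        exp (- (2 * real j) / N + - (real j * (real j - 1)) / N)"
      by (simp only: exp_add mult_ac)
    also have "- (2 * real j) / N + - (real j * (real j - 1)) / N
             = - (real (Suc j) * (real (Suc j) - 1)) / N"
      using assms(3) by (simp add: field_simps)
    finally show ?thesis .
  qed
qed auto

text \<open>
  The same argument applied to the inverse quotient
  \<open>(b + j + 1) / (a - j) \<le> 1 + 2 (j + 1) / M \<le> exp (2 (j + 1) / M)\<close>.
\<close>

lemma binomial_gaussian_lower:
  fixes a b j :: nat and M :: real
  assumes "b \<le> a + 1" "M \<le> real a - real j + 1" "0 < M" "j \<le> a"
  shows "real ((a + b) choose b) * exp (- (real j * (real j + 1)) / M) \<le>
         real ((a + b) choose (b + j))"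
  using assms(2,4)
proof (induction j)
  case (Suc j)
  have IH: "real ((a + b) choose b) * exp (- (real j * (real j + 1)) / M) \<le>
         real ((a + b) choose (b + j))"
    using Suc by simp
  have ja: "j < a" using Suc.prems by simp
  note rec = binomial_Suc_ratio[OF ja, of b]
  have step: "exp (- (2 * (real j + 1)) / M) \<le> (real a - real j) / real (Suc (b + j))"
  proof -
    have pos: "0 < real a - real j" using ja by simp
    have "real (Suc (b + j)) / (real a - real j) \<le> 1 + 2 * (real j + 1) / (real a - real j)"
    proof -
      have "real (Suc (b + j)) \<le> (real a - real j) + 2 * (real j + 1)"
        using assms(1) by simp
      then have "real (Suc (b + j)) / (real a - real j) \<le>
          ((real a - real j) + 2 * (real j + 1)) / (real a - real j)"
        using pos by (intro divide_right_mono) auto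
      also have "\<dots> = 1 + 2 * (real j + 1) / (real a - real j)"
        using pos by (subst add_divide_distrib) simp
      finally show ?thesis .
    qed
    also have "\<dots> \<le> 1 + 2 * (real j + 1) / M"
      using Suc.prems pos assms(3) by (intro add_left_mono divide_left_mono) auto
    also have "\<dots> \<le> exp (2 * (real j + 1) / M)" by (rule exp_ge_add_one_self)
    finally have "inverse (exp (2 * (real j + 1) / M)) \<le>
        inverse (real (Suc (b + j)) / (real a - real j))"
      using pos by (intro le_imp_inverse_le) (auto intro!: divide_pos_pos)
    then show ?thesis by (simp only: exp_minus[symmetric] inverse_divide minus_divide_left)
  qed
  have "- (real (Suc j) * (real (Suc j) + 1)) / M
      = - (2 * (real j + 1)) / M + - (real j * (real j + 1)) / M"
    using assms(3) by (simp add: field_simps)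
  then have "real ((a + b) choose b) * exp (- (real (Suc j) * (real (Suc j) + 1)) / M)
      = exp (- (2 * (real j + 1)) / M) *
        (real ((a + b) choose b) * exp (- (real j * (real j + 1)) / M))"
    by (simp only: exp_add mult_ac)
  also have "\<dots> \<le> (real a - real j) / real (Suc (b + j)) * real ((a + b) choose (b + j))"
    using step IH ja by (intro mult_mono) auto
  also have "\<dots> = real ((a + b) choose (b + Suc j))"
    using rec by (simp add: field_simps)
  finally show ?case .
qed auto

text \<open>
  The row \<open>n\<close> of Pascal's triangle, normalised to have value 1 at its centre \<open>n div 2\<close> and indexed by
  the signed distance from it. The cut-off matters because \<open>nat\<close> would send all negative
  positions to \<open>0\<close>, where the coefficient is \<open>1\<close>.
\<close>

definition central_ratio :: "nat \<Rightarrow> int \<Rightarrow> real" where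
  "central_ratio n k =
     (if 0 \<le> int (n div 2) + k
      then real (n choose nat (int (n div 2) + k)) / real (n choose (n div 2)) else 0)"

text \<open>
  By the symmetry of the row, positions left of the centre are positions right of \<open>n - n div 2\<close>, so
  that both halves are covered by the one-sided bounds above; the parity of \<open>n\<close> enters only
  through \<open>\<bar>a - b\<bar> \<le> 1\<close>. Positions outside the row are included, the ratio and the
  coefficient on the right both being \<open>0\<close>.
\<close>

lemma central_ratio_reflect:
  obtains a b where "n = a + b" "a \<le> b + 1" "b \<le> a + 1"
    "central_ratio n k = real ((a + b) choose (b + nat \<bar>k\<bar>)) / real ((a + b) choose b)"
proof (cases "0 \<le> k")
  case True
  have "nat (int (n div 2) + k) = n div 2 + nat \<bar>k\<bar>" using True by simp
  then have "central_ratio n k =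
      real (n choose (n div 2 + nat \<bar>k\<bar>)) / real (n choose (n div 2))"
    using True by (simp add: central_ratio_def)
  then show ?thesis using that[of "n - n div 2" "n div 2"] by simp
next
  case False
  define m where "m = n div 2"
  have m: "m \<le> n" by (simp add: m_def)
  have "central_ratio n k =
      real (n choose (n - m + nat \<bar>k\<bar>)) / real (n choose (n - m))"
  proof (cases "0 \<le> int m + k")
    case True
    then have "n - nat (int m + k) = n - m + nat \<bar>k\<bar>" "nat (int m + k) \<le> n"
      using False m by linarith+
    then have "n choose nat (int m + k) = n choose (n - m + nat \<bar>k\<bar>)"
      using binomial_symmetric[of "nat (int m + k)" n] by simp
    then show ?thesis using True binomial_symmetric[OF m] by (simp add: central_ratio_def m_def)
  next
    case False
    then have "n choose (n - m + nat \<bar>k\<bar>) = 0" by (intro binomial_eq_0) linarith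
    then show ?thesis using False by (simp add: central_ratio_def m_def)
  qed
  then show ?thesis using that[of m "n - m"] by (simp add: m_def)
qed

lemma central_ratio_nonneg: "0 \<le> central_ratio n k"
  by (simp add: central_ratio_def)

lemma real_nat_mult_pred_nonneg: "0 \<le> real j * (real j - 1)"
  by (cases j) auto

lemma central_ratio_le:
  "central_ratio n k \<le> exp (- (real (nat \<bar>k\<bar>) * (real (nat \<bar>k\<bar>) - 1)) / ((real n + 1) / 2 + real (nat \<bar>k\<bar>)))"
proof -
  obtain a b where *: "n = a + b" "a \<le> b + 1" "b \<le> a + 1"
    "central_ratio n k = real ((a + b) choose (b + nat \<bar>k\<bar>)) / real ((a + b) choose b)"
    by (rule central_ratio_reflect)
  have "0 < (real n + 1) / 2 + real (nat \<bar>k\<bar>)" by (intro add_pos_nonneg) auto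
  then show ?thesis
    using binomial_gaussian_upper[of a b "nat \<bar>k\<bar>" "(real n + 1) / 2 + real (nat \<bar>k\<bar>)"] *
    by (simp add: pos_divide_le_eq mult.commute)
qed

lemma central_ratio_ge:
  assumes "real (nat \<bar>k\<bar>) < (real n + 1) / 2"
  shows "exp (- (real (nat \<bar>k\<bar>) * (real (nat \<bar>k\<bar>) + 1)) / ((real n + 1) / 2 - real (nat \<bar>k\<bar>)))
         \<le> central_ratio n k"
proof -
  obtain a b where *: "n = a + b" "a \<le> b + 1" "b \<le> a + 1"
    "central_ratio n k = real ((a + b) choose (b + nat \<bar>k\<bar>)) / real ((a + b) choose b)"
    by (rule central_ratio_reflect)
  have "real (2 * nat \<bar>k\<bar>) < real (n + 1)" using assms by (simp only: of_nat_mult of_nat_add) simp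
  then have "2 * nat \<bar>k\<bar> < n + 1" by (simp only: of_nat_less_iff)
  then have "nat \<bar>k\<bar> \<le> a" using * by linarith
  then show ?thesis
    using binomial_gaussian_lower[of b a "(real n + 1) / 2 - real (nat \<bar>k\<bar>)" "nat \<bar>k\<bar>"] * assms
    by (simp add: pos_le_divide_eq mult.commute)
qed

lemma central_ratio_le_uniform:
  assumes "n > 0"
  shows "central_ratio n k \<le> exp (- (real (nat \<bar>k\<bar>) * (real (nat \<bar>k\<bar>) - 1)) / real n)"
proof -
  obtain a b where *: "n = a + b" "a \<le> b + 1" "b \<le> a + 1"
    "central_ratio n k = real ((a + b) choose (b + nat \<bar>k\<bar>)) / real ((a + b) choose b)"
    by (rule central_ratio_reflect)
  show ?thesis
  proof (cases "nat \<bar>k\<bar> \<le> a")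
    case True
    then show ?thesis
      using binomial_gaussian_upper[of a b "nat \<bar>k\<bar>" "real n"] * assms
      by (simp add: pos_divide_le_eq mult.commute)
  next
    case False
    then have "(a + b) choose (b + nat \<bar>k\<bar>) = 0" by (intro binomial_eq_0) simp
    with * show ?thesis by simp
  qed
qed

lemma central_ratio_le_one: "central_ratio n k \<le> 1"
proof -
  have "- (real (nat \<bar>k\<bar>) * (real (nat \<bar>k\<bar>) - 1)) / ((real n + 1) / 2 + real (nat \<bar>k\<bar>)) \<le> 0"
    using real_nat_mult_pred_nonneg[of "nat \<bar>k\<bar>"] by (intro divide_nonpos_nonneg) auto
  then show ?thesis using central_ratio_le[of n k] exp_le_one_iff order_trans by blast
qed

text \<open>
  The distance \<open>J\<close> from the centre of the step containing \<open>y = x sqrt n\<close> satisfies \<open>J \<ge> \<bar>y\<bar> - 1\<close>, so the exponent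
  \<open>J (J - 1) / n\<close> is at least \<open>x\<^sup>2 - 3 \<bar>x\<bar>\<close>, and completing the square
  absorbs the linear term into half of the quadratic one.
\<close>

lemma central_ratio_dominated:
  assumes "n > 0"
  shows "central_ratio n \<lfloor>sqrt (real n) * x\<rfloor> \<le> exp (9 / 2) * exp (- x\<^sup>2 / 2)"
proof -
  define J where "J = real (nat \<bar>\<lfloor>sqrt (real n) * x\<rfloor>\<bar>)"
  define y where "y = sqrt (real n) * \<bar>x\<bar>"
  have y: "y = \<bar>sqrt (real n) * x\<bar>" by (simp add: y_def abs_mult)
  have Jy: "J \<ge> y - 1" unfolding J_def y by linarith
  have "J * (J - 1) \<ge> y\<^sup>2 - 3 * y"
  proof (cases "y \<ge> 2")
    case True
    then have "(y - 1) * (y - 2) \<le> J * (J - 1)" using Jy by (intro mult_mono) auto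
    then show ?thesis by (simp add: power2_eq_square algebra_simps)
  next
    case False
    have "y \<ge> 0" by (simp add: y)
    then have "y * (y - 3) \<le> 0" using False by (intro mult_nonneg_nonpos) auto
    also have "0 \<le> J * (J - 1)" unfolding J_def by (rule real_nat_mult_pred_nonneg)
    finally show ?thesis by (simp add: power2_eq_square algebra_simps)
  qed
  then have "(y\<^sup>2 - 3 * y) / real n \<le> J * (J - 1) / real n"
    by (intro divide_right_mono) auto
  moreover have "(y\<^sup>2 - 3 * y) / real n \<ge> x\<^sup>2 - 3 * \<bar>x\<bar>"
  proof -
    have "y\<^sup>2 / real n = x\<^sup>2" using assms by (simp add: y_def power_mult_distrib)
    moreover have "y / real n \<le> \<bar>x\<bar>"
    proof -
      have "1 \<le> sqrt (real n)" using assms by simp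
      then have "sqrt (real n) * 1 \<le> sqrt (real n) * sqrt (real n)"
        by (intro mult_left_mono) auto
      then have "sqrt (real n) \<le> real n" by simp
      then have "y \<le> real n * \<bar>x\<bar>" unfolding y_def by (intro mult_right_mono) auto
      then show ?thesis using assms by (simp add: field_simps)
    qed
    ultimately show ?thesis by (simp add: diff_divide_distrib)
  qed
  moreover have "x\<^sup>2 - 3 * \<bar>x\<bar> \<ge> x\<^sup>2 / 2 - 9 / 2"
    using zero_le_power2[of "\<bar>x\<bar> - 3"] by (simp add: power2_diff)
  ultimately have "- (J * (J - 1)) / real n \<le> 9 / 2 + - x\<^sup>2 / 2" by simp
  then have "exp (- (J * (J - 1)) / real n) \<le> exp (9 / 2) * exp (- x\<^sup>2 / 2)"
    by (simp only: exp_add[symmetric] exp_le_cancel_iff)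
  with central_ratio_le_uniform[OF assms, of "\<lfloor>sqrt (real n) * x\<rfloor>"] show ?thesis
    unfolding J_def by linarith
qed

text \<open>
  Squeezed between the two Gaussian bounds: with \<open>t = J / sqrt n \<longrightarrow> \<bar>x\<bar>\<close> the exponents are
  \<open>t (t \<plusminus> 1 / sqrt n) / ((1 + 1/n) / 2 \<minusplus> t / sqrt n)\<close>, up to sign,
  and tend to \<open>\<bar>x\<bar>\<^sup>2 / (1/2)\<close>. The signs are the parameters \<open>e\<close> and \<open>e'\<close> below.
\<close>

lemma central_ratio_tendsto:
  "(\<lambda>n. central_ratio n \<lfloor>sqrt (real n) * x\<rfloor>) \<longlonglongrightarrow> exp (- 2 * x\<^sup>2)"
proof -
  define J where "J n = real (nat \<bar>\<lfloor>sqrt (real n) * x\<rfloor>\<bar>)" for n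
  define t where "t n = J n / sqrt (real n)" for n
  have inv: "(\<lambda>n. 1 / sqrt (real n)) \<longlonglongrightarrow> 0" by real_asymp
  have inv': "(\<lambda>n. 1 / real n) \<longlonglongrightarrow> 0" by real_asymp
  have t: "t \<longlonglongrightarrow> \<bar>x\<bar>"
  proof (rule LIM_zero_cancel, rule Lim_null_comparison[OF _ inv])
    show "\<forall>\<^sub>F n in sequentially. norm (t n - \<bar>x\<bar>) \<le> 1 / sqrt (real n)"
      using eventually_gt_at_top[of 0]
    proof eventually_elim
      case (elim n)
      have "\<bar>J n - \<bar>sqrt (real n) * x\<bar>\<bar> \<le> 1" unfolding J_def by linarith
      then have "\<bar>J n - \<bar>sqrt (real n) * x\<bar>\<bar> / sqrt (real n) \<le> 1 / sqrt (real n)"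
        by (intro divide_right_mono) auto
      moreover have "t n - \<bar>x\<bar> = (J n - \<bar>sqrt (real n) * x\<bar>) / sqrt (real n)"
        using elim by (simp add: t_def abs_mult field_simps)
      ultimately show ?case by simp
    qed
  qed
  have J: "J n = t n * sqrt (real n)" if "n > 0" for n using that by (simp add: t_def)
  have tn: "(\<lambda>n. t n * (1 / sqrt (real n))) \<longlonglongrightarrow> \<bar>x\<bar> * 0" by (intro tendsto_mult t inv)
  have exponent: "- (J n * (J n + e)) / ((real n + 1) / 2 + e' * J n)
     = - (t n * (t n + e * (1 / sqrt (real n)))) / ((1 + 1 / real n) / 2 + e' * (t n * (1 / sqrt (real n))))"
    if "n > 0" for n and e e' :: real
  proof -
    have n: "real n = sqrt (real n) * sqrt (real n)" by simp
    have "- (t n * (t n + e * (1 / sqrt (real n)))) = - (J n * (J n + e)) / real n"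
      using that by (simp add: t_def add_divide_distrib[symmetric])
    moreover have "(1 + 1 / real n) / 2 + e' * (t n * (1 / sqrt (real n))) = ((real n + 1) / 2 + e' * J n) / real n"
      using that by (simp add: t_def add_divide_distrib)
    ultimately show ?thesis using that by simp
  qed
  have lim: "(\<lambda>n. exp (- (J n * (J n + e)) / ((real n + 1) / 2 + e' * J n))) \<longlonglongrightarrow> exp (- 2 * x\<^sup>2)"
    for e e' :: real
  proof -
    have "(\<lambda>n. exp (- (t n * (t n + e * (1 / sqrt (real n)))) /
            ((1 + 1 / real n) / 2 + e' * (t n * (1 / sqrt (real n))))))
       \<longlonglongrightarrow> exp (- (\<bar>x\<bar> * (\<bar>x\<bar> + e * 0)) / ((1 + 0) / 2 + e' * (\<bar>x\<bar> * 0)))"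
      by (intro tendsto_intros t inv inv' tn) auto
    also have "- (\<bar>x\<bar> * (\<bar>x\<bar> + e * 0)) / ((1 + 0) / 2 + e' * (\<bar>x\<bar> * 0)) = - 2 * x\<^sup>2"
      by (simp add: power2_eq_square)
    finally show ?thesis
    proof (rule Lim_transform_eventually)
      show "\<forall>\<^sub>F n in sequentially. exp (- (t n * (t n + e * (1 / sqrt (real n)))) /
            ((1 + 1 / real n) / 2 + e' * (t n * (1 / sqrt (real n))))) =
            exp (- (J n * (J n + e)) / ((real n + 1) / 2 + e' * J n))"
        using eventually_gt_at_top[of 0] by eventually_elim (simp only: exponent)
    qed
  qed
  show ?thesis
  proof (rule tendsto_sandwich[OF _ _ lim[of 1 "-1"] lim[of "-1" 1]])
    have "\<forall>\<^sub>F n in sequentially. t n * (1 / sqrt (real n)) < 1 / 2"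
      by (rule order_tendstoD[OF tn]) simp
    then show "\<forall>\<^sub>F n in sequentially. exp (- (J n * (J n + 1)) / ((real n + 1) / 2 + - 1 * J n))
        \<le> central_ratio n \<lfloor>sqrt (real n) * x\<rfloor>"
      using eventually_gt_at_top[of 0]
    proof eventually_elim
      case (elim n)
      have "J n / real n < 1 / 2" using elim by (simp add: t_def)
      then have "J n < (real n + 1) / 2" using elim by (simp add: field_simps)
      then show ?case using central_ratio_ge[of "\<lfloor>sqrt (real n) * x\<rfloor>" n] by (simp add: J_def)
    qed
    show "\<forall>\<^sub>F n in sequentially. central_ratio n \<lfloor>sqrt (real n) * x\<rfloor>
        \<le> exp (- (J n * (J n + - 1)) / ((real n + 1) / 2 + 1 * J n))"
      using central_ratio_le by (simp add: J_def)
  qed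
qed

section \<open>Sums as integrals, and the limit\<close>

lemma integral_floor_step:
  fixes g :: "int \<Rightarrow> real" and c :: real
  assumes "finite S" "\<And>k. k \<notin> S \<Longrightarrow> g k = 0" "0 < c"
  shows "(\<integral>x. g \<lfloor>c * x\<rfloor> \<partial>lborel) = (\<Sum>k\<in>S. g k) / c"
proof -
  have eq: "g \<lfloor>y\<rfloor> = (\<Sum>k\<in>S. g k * indicator {real_of_int k..<real_of_int k + 1} y)" for y
  proof -
    have "(\<Sum>k\<in>S. g k * indicator {real_of_int k..<real_of_int k + 1} y)
        = (\<Sum>k\<in>S. if k = \<lfloor>y\<rfloor> then g k else 0)"
    proof (intro sum.cong refl)
      fix k
      show "g k * indicator {real_of_int k..<real_of_int k + 1} y = (if k = \<lfloor>y\<rfloor> then g k else 0)"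
        using floor_eq_iff[of y k] by (auto simp: indicator_def)
    qed
    also have "\<dots> = g \<lfloor>y\<rfloor>" using assms(1,2) by (simp add: sum.delta)
    finally show ?thesis by simp
  qed
  have "(\<integral>y. g \<lfloor>y::real\<rfloor> \<partial>lborel) = (\<Sum>k\<in>S. g k)"
  proof -
    have "(\<integral>y. g \<lfloor>y::real\<rfloor> \<partial>lborel)
        = (\<integral>y. (\<Sum>k\<in>S. g k * indicator {real_of_int k..<real_of_int k + 1} y) \<partial>lborel)"
      by (intro Bochner_Integration.integral_cong refl eq)
    also have "\<dots> = (\<Sum>k\<in>S. (\<integral>y. g k * indicator {real_of_int k..<real_of_int k + 1} y \<partial>lborel))"
      by (rule Bochner_Integration.integral_sum) auto
    finally show ?thesis by simp
  qed
  moreover have "(\<integral>y. g \<lfloor>y::real\<rfloor> \<partial>lborel) = c * (\<integral>x. g \<lfloor>c * x\<rfloor> \<partial>lborel)"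
    using lborel_integral_real_affine[of c "\<lambda>y. g \<lfloor>y\<rfloor>" 0] assms(3) by simp
  ultimately show ?thesis using assms(3) by (simp add: field_simps)
qed

lemma gaussian_integrable_integral:
  fixes a :: real
  assumes "a > 0"
  shows integrable_gaussian: "integrable lborel (\<lambda>x. exp (- a * x\<^sup>2))"
    and integral_gaussian: "(\<integral>x. exp (- a * x\<^sup>2) \<partial>lborel) = sqrt (pi / a)"
proof -
  define \<sigma> where "\<sigma> = 1 / sqrt (2 * a)"
  have sq: "2 * \<sigma>\<^sup>2 = 1 / a" using assms by (simp add: \<sigma>_def power_divide)
  have eq: "(\<lambda>x. exp (- a * x\<^sup>2)) = (\<lambda>x. sqrt (pi / a) * normal_density 0 \<sigma> x)"
  proof
    fix x
    have "2 * pi * \<sigma>\<^sup>2 = pi / a" using sq by (simp add: field_simps)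
    then show "exp (- a * x\<^sup>2) = sqrt (pi / a) * normal_density 0 \<sigma> x"
      using assms sq by (simp add: normal_density_def mult.commute)
  qed
  have "\<sigma> > 0" using assms by (simp add: \<sigma>_def)
  then show "integrable lborel (\<lambda>x. exp (- a * x\<^sup>2))"
    and "(\<integral>x. exp (- a * x\<^sup>2) \<partial>lborel) = sqrt (pi / a)"
    unfolding eq by simp_all
qed

lemma sum_binomial_power_eq_integral:
  assumes "d \<ge> 1" "n > 0"
  shows "(\<Sum>k\<le>n. real (n choose k) ^ d) =
    real (n choose (n div 2)) ^ d * sqrt (real n) *
      (\<integral>x. central_ratio n \<lfloor>sqrt (real n) * x\<rfloor> ^ d \<partial>lborel)"
proof -
  let ?m = "int (n div 2)" and ?c = "real (n choose (n div 2))"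
  let ?S = "{- ?m..int n - ?m}"
  have c: "?c > 0" by simp
  have "(\<Sum>k\<le>n. real (n choose k) ^ d) = (\<Sum>k\<in>?S. ?c ^ d * central_ratio n k ^ d)"
    by (rule sum.reindex_bij_witness[of _ "\<lambda>k. nat (?m + k)" "\<lambda>k. int k - ?m"])
       (auto simp: central_ratio_def power_divide)
  also have "\<dots> = ?c ^ d * (\<Sum>k\<in>?S. central_ratio n k ^ d)" by (simp add: sum_distrib_left)
  also have "(\<Sum>k\<in>?S. central_ratio n k ^ d) =
      sqrt (real n) * (\<integral>x. central_ratio n \<lfloor>sqrt (real n) * x\<rfloor> ^ d \<partial>lborel)"
  proof -
    have "central_ratio n k ^ d = 0" if "k \<notin> ?S" for k
    proof -
      have "central_ratio n k = 0"
        using that by (auto simp: central_ratio_def intro!: binomial_eq_0)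
      then show ?thesis using assms(1) by simp
    qed
    then show ?thesis
      using integral_floor_step[of ?S "\<lambda>k. central_ratio n k ^ d" "sqrt (real n)"] assms(2) by simp
  qed
  finally show ?thesis by (simp add: mult.assoc)
qed

text \<open>
  Dominated convergence is applied from \<open>n = 1\<close> on: for \<open>n = 0\<close> the step function is the
  constant \<open>1\<close>, which is not integrable.
\<close>

lemma sum_binomial_power_tendsto:
  assumes "d \<ge> 1"
  shows "(\<lambda>n. (\<Sum>k\<le>n. real (n choose k) ^ d) / (real (n choose (n div 2)) ^ d * sqrt (real n)))
         \<longlonglongrightarrow> sqrt (pi / (2 * real d))"
proof -
  let ?f = "\<lambda>n x. central_ratio n \<lfloor>sqrt (real n) * x\<rfloor> ^ d"
  have "(\<lambda>n. \<integral>x. ?f (Suc n) x \<partial>lborel) \<longlonglongrightarrow> (\<integral>x. exp (- (2 * real d) * x\<^sup>2) \<partial>lborel)"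
  proof (rule integral_dominated_convergence[where w = "\<lambda>x. exp (9 / 2) * exp (- (1 / 2) * x\<^sup>2)"])
    show "AE x in lborel. (\<lambda>n. ?f (Suc n) x) \<longlonglongrightarrow> exp (- (2 * real d) * x\<^sup>2)"
    proof (rule AE_I2)
      fix x
      have "(\<lambda>n. ?f n x) \<longlonglongrightarrow> exp (- 2 * x\<^sup>2) ^ d"
        by (intro tendsto_power central_ratio_tendsto)
      also have "exp (- 2 * x\<^sup>2) ^ d = exp (- (2 * real d) * x\<^sup>2)"
        by (simp add: exp_of_nat_mult[symmetric] mult_ac)
      finally show "(\<lambda>n. ?f (Suc n) x) \<longlonglongrightarrow> exp (- (2 * real d) * x\<^sup>2)"
        by (rule LIMSEQ_Suc)
    qed
    show "AE x in lborel. norm (?f (Suc n) x) \<le> exp (9 / 2) * exp (- (1 / 2) * x\<^sup>2)" for n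
    proof (rule AE_I2)
      fix x :: real
      let ?r = "central_ratio (Suc n) \<lfloor>sqrt (real (Suc n)) * x\<rfloor>"
      have "?r ^ d \<le> ?r ^ 1"
        using assms by (intro power_decreasing central_ratio_nonneg central_ratio_le_one)
      also have "\<dots> \<le> exp (9 / 2) * exp (- x\<^sup>2 / 2)"
        using central_ratio_dominated[of "Suc n" x] by simp
      finally show "norm (?r ^ d) \<le> exp (9 / 2) * exp (- (1 / 2) * x\<^sup>2)"
        using central_ratio_nonneg by simp
    qed
    show "integrable lborel (\<lambda>x::real. exp (9 / 2) * exp (- (1 / 2) * x\<^sup>2))"
      by (intro integrable_mult_right integrable_gaussian) simp
  qed (measurable)
  then have "(\<lambda>n. \<integral>x. ?f n x \<partial>lborel) \<longlonglongrightarrow> (\<integral>x. exp (- (2 * real d) * x\<^sup>2) \<partial>lborel)"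
    by (rule LIMSEQ_imp_Suc)
  also have "(\<integral>x. exp (- (2 * real d) * x\<^sup>2) \<partial>lborel) = sqrt (pi / (2 * real d))"
    using assms by (intro integral_gaussian) simp
  finally show ?thesis
  proof (rule Lim_transform_eventually)
    show "\<forall>\<^sub>F n in sequentially. (\<integral>x. ?f n x \<partial>lborel) =
        (\<Sum>k\<le>n. real (n choose k) ^ d) / (real (n choose (n div 2)) ^ d * sqrt (real n))"
      using eventually_gt_at_top[of 0]
      by eventually_elim (simp add: sum_binomial_power_eq_integral[OF assms])
  qed
qed

text \<open>
  Here \<open>A\<close> is the normalised sum for the exponent \<open>d\<close> and \<open>B\<close> the one for exponent \<open>1\<close>, which
  is \<open>2 ^ n / (c\<^sub>n sqrt n)\<close>. In \<open>A / B ^ d\<close> the central coefficient cancels.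
\<close>

lemma sum_binomial_power_asymp:
  assumes "d \<ge> 1"
  shows "(\<lambda>n. \<Sum>k\<le>n. real (n choose k) ^ d) \<sim>[at_top]
         (\<lambda>n. 2 ^ (n * d) * (pi * real n / 2) powr (- real d / 2 + 1 / 2)
                    * real d powr (- 1 / 2))"
proof (rule asymp_equivI')
  define q where "q = sqrt (pi / 2)"
  have q: "q > 0" by (simp add: q_def)
  define c where "c n = real (n choose (n div 2))" for n
  have c: "c n > 0" for n by (simp add: c_def)
  define A where "A n = (\<Sum>k\<le>n. real (n choose k) ^ d) / (c n ^ d * sqrt (real n))" for n
  define B where "B n = 2 ^ n / (c n * sqrt (real n))" for n
  have A: "A \<longlonglongrightarrow> q / sqrt (real d)"
    using sum_binomial_power_tendsto[OF assms]
    by (simp add: A_def[abs_def] c_def q_def real_sqrt_divide real_sqrt_mult)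
  have "(\<Sum>k\<le>n. real (n choose k)) = 2 ^ n" for n
    using choose_row_sum[of n] by (metis of_nat_sum of_nat_power of_nat_numeral)
  then have B: "B \<longlonglongrightarrow> q"
    using sum_binomial_power_tendsto[of 1] by (simp add: B_def[abs_def] c_def q_def)
  have "(\<lambda>n. A n / B n ^ d * (q ^ d / q * sqrt (real d))) \<longlonglongrightarrow>
        q / sqrt (real d) / q ^ d * (q ^ d / q * sqrt (real d))"
    using q by (intro tendsto_intros A B) auto
  also have "q / sqrt (real d) / q ^ d * (q ^ d / q * sqrt (real d)) = 1"
    using q assms by (simp add: field_simps)
  finally show "(\<lambda>n. (\<Sum>k\<le>n. real (n choose k) ^ d) /
      (2 ^ (n * d) * (pi * real n / 2) powr (- real d / 2 + 1 / 2) * real d powr (- 1 / 2)))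
      \<longlonglongrightarrow> 1"
  proof (rule Lim_transform_eventually)
    show "\<forall>\<^sub>F n in sequentially. A n / B n ^ d * (q ^ d / q * sqrt (real d)) =
      (\<Sum>k\<le>n. real (n choose k) ^ d) /
      (2 ^ (n * d) * (pi * real n / 2) powr (- real d / 2 + 1 / 2) * real d powr (- 1 / 2))"
      using eventually_gt_at_top[of 0]
    proof eventually_elim
      case (elim n)
      define s where "s = sqrt (real n)"
      have s: "s > 0" using elim by (simp add: s_def)
      have "pi * real n / 2 = (q * s) powr 2"
        using q s elim by (simp add: q_def s_def power_mult_distrib)
      then have "(pi * real n / 2) powr (- real d / 2 + 1 / 2) = (q * s) powr (1 - real d)"
        by (simp add: powr_powr algebra_simps)
      also have "\<dots> = q * s / (q * s) ^ d"
        using q s by (simp add: powr_diff powr_realpow)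
      finally have p: "(pi * real n / 2) powr (- real d / 2 + 1 / 2) = q * s / (q * s) ^ d" .
      have r: "real d powr (- 1 / 2) = 1 / sqrt (real d)"
        using assms by (simp add: powr_minus_divide powr_half_sqrt)
      show ?case
        unfolding p r A_def B_def s_def[symmetric]
        using q s c[of n] assms by (simp add: power_mult[symmetric] power_mult_distrib power_divide field_simps)
    qed
  qed
qed

theorem mainTheorem2:
  fixes d :: nat
  assumes "d \<ge> 1"
  shows "(\<lambda>n::nat. real (num_simple_jump_paths d (n + 1))) \<sim>[at_top]
         (\<lambda>n::nat. 2 ^ (n * d) * (pi * real n / 2) powr (- real d / 2 + 1 / 2)
                    * real d powr (- 1 / 2))"
  using sum_binomial_power_asymp[OF assms]
  by (simp only: num_simple_jump_paths_eq_sum[OF assms] of_nat_sum of_nat_power)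

end
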